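(* Let $k\geq 4$ be an integer and $c>0$. If $R_r(3)\leq (3-c)\,r!\,(1+o(1))$ as $r\to\infty$, then, as $r\to\infty$ (over integers $r\geq 2$), \[ R_r(k)\leq \left(3-\frac{c}{2}\right)\frac{(r(k-2))!}{((k-2)!)^r}\left(1+o_{r\to\infty}(1)\right). \]
   Context: For integers $r\geq 1$ and $k\geq 1$, the diagonal Ramsey number $R_r(k)$ is the minimum $N\in\mathbb{N}$ such that every coloring of the edges of the complete graph $K_N$ with $r$ colors contains a complete subgraph on $k$ vertices all of whose edges have the same color. $o(1)$ and $o_{r\to\infty}(1)$ denote quantities tending to $0$ as $r\to\infty$. *)

theory Defs
  imports Complex_Main "HOL-Library.Ramsey"
begin

text \<open>
  The edges of the complete graph on the vertex set \<open>{..<N}\<close> are its 2-element subsets, and the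
  colors are \<open>{..<r}\<close>.
\<close>
definition ramsey_number :: "nat \<Rightarrow> nat \<Rightarrow> nat" where
  "ramsey_number r k = (LEAST N. partn {..<N} k 2 {..<r})"

text \<open>For \<open>r \<ge> 1\<close> the minimum exists, so \<open>LEAST\<close> is meaningful.\<close>
lemma partn_ramsey_number:
  "partn {..<ramsey_number r k} k 2 {..<r}" if "r \<ge> 1"
proof -
  obtain N :: nat where "partn_lst {..<N} (replicate r k) 2"
    using ramsey_full by blast
  then have "partn {..<N} k 2 {..<r}"
    by (fastforce simp: partn_lst_def partn_def)
  then show ?thesis
    unfolding ramsey_number_def by (rule LeastI)
qed

end

theory Submission
  imports Defs
begin

text \<open>
  Write \<open>j\<^sub>i + 2\<close> for the clique size sought in colour \<open>i\<close> and let \<open>R(j)\<close> be the corresponding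
  off-diagonal Ramsey number. The neighbourhood argument gives
  \<open>R(j) - 1 \<le> 1 + \<Sum>\<^sub>i (R(j - e\<^sub>i) - 1)\<close>, the sum being over the \<open>i\<close> with \<open>j\<^sub>i > 0\<close>. The multinomial
  coefficient \<open>M(j)\<close> of total \<open>n = \<Sum>\<^sub>i j\<^sub>i\<close> and \<open>Q(j) = M(j) \<Sum>\<^sub>i j\<^sub>i (j\<^sub>i - 1) / (n (n - 1))\<close> both
  satisfy \<open>g(j) = \<Sum>\<^sub>i g(j - e\<^sub>i)\<close>. Fix \<open>S > k - 2\<close> with \<open>R\<^sub>S(3) \<le> (3 - c/2) S!\<close>. On the level
  \<open>n = S\<close>, the vectors with entries in \<open>{0, 1}\<close> satisfy \<open>R(j) \<le> (3 - c/2) M(j)\<close>, while on all others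
  \<open>Q\<close> is bounded away from \<open>0\<close>; so \<open>R(j) \<le> (3 - c/2) M(j) + b Q(j)\<close> there for a constant \<open>b\<close>, and
  the recursion propagates this to all \<open>n \<ge> S\<close>. (The additive \<open>1\<close> is absorbed because \<open>S > k - 2\<close>
  forces at least two nonzero entries.) At \<open>j = (k - 2, \<dots>, k - 2)\<close> the ratio \<open>Q(j) / M(j)\<close> is
  \<open>(k - 3) / (r (k - 2) - 1)\<close>, which tends to \<open>0\<close>.
\<close>

section \<open>Off-diagonal Ramsey numbers\<close>

text \<open>Cliques of size \<open>j i + 2\<close> make \<open>j i = 0\<close> mean that a single
  edge of colour \<open>i\<close> suffices. Letting \<open>V\<close> range over all finite sets with
  at least \<open>N\<close> vertices allows a direct application to neighbourhoods and makes
  monotonicity in \<open>N\<close> immediate.\<close>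

definition arrows :: "nat \<Rightarrow> nat set \<Rightarrow> (nat \<Rightarrow> nat) \<Rightarrow> bool" where
  "arrows N C j \<longleftrightarrow> (\<forall>V :: nat set. \<forall>f. finite V \<longrightarrow> N \<le> card V \<longrightarrow> f \<in> nsets V 2 \<rightarrow> C \<longrightarrow>
      (\<exists>i\<in>C. monochromatic V (j i + 2) 2 f i))"

lemma monochromatic_superset:
  "monochromatic U m n f i \<Longrightarrow> U \<subseteq> V \<Longrightarrow> monochromatic V m n f i"
  unfolding monochromatic_def using nsets_mono[of U V m] by blast

lemma monochromatic_smaller:
  assumes "monochromatic V m n f i" "m' \<le> m"
  shows "monochromatic V m' n f i"
proof -
  obtain H where H: "H \<in> nsets V m" "f ` nsets H n \<subseteq> {i}"
    using assms by (auto simp: monochromatic_def)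
  obtain H' where H': "H' \<subseteq> H" "card H' = m'" "finite H'"
    using H assms(2) obtain_subset_with_card_n[of m' H] by (auto simp: nsets_def)
  then have "H' \<in> nsets V m'"
    using H by (auto simp: nsets_def)
  moreover have "f ` nsets H' n \<subseteq> {i}"
    using H nsets_mono[OF H'(1), of n] by blast
  ultimately show ?thesis by (auto simp: monochromatic_def)
qed

lemma monochromatic_edge:
  assumes "e \<in> nsets V 2"
  shows "monochromatic V 2 2 f (f e)"
proof -
  have "nsets e 2 = {e}"
    by (rule nsets2_E[OF assms]) simp
  then show ?thesis
    using assms by (auto simp: monochromatic_def)
qed

text \<open>Neighbourhood argument at a vertex \<open>v\<close>: unless some edge at
  \<open>v\<close> has a colour with \<open>j i = 0\<close> and is itself the clique sought, the
  other vertices, more than the sum of the \<open>n i\<close>, split by the colour of their edge to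
  \<open>v\<close>, and the pigeonhole principle applies.\<close>

lemma arrows_step:
  assumes C: "finite C"
    and sub: "\<And>i. i \<in> C \<Longrightarrow> 0 < j i \<Longrightarrow> arrows (n i + 1) C (j(i := j i - 1))"
  shows "arrows (2 + (\<Sum>i\<in>{i\<in>C. 0 < j i}. n i)) C j"
  unfolding arrows_def
proof (intro allI impI)
  fix V :: "nat set" and f
  assume V: "finite V" "2 + (\<Sum>i\<in>{i\<in>C. 0 < j i}. n i) \<le> card V" and f: "f \<in> nsets V 2 \<rightarrow> C"
  define P where "P = {i\<in>C. 0 < j i}"
  obtain v where v: "v \<in> V" using V by fastforce
  define U where "U i = {u \<in> V - {v}. f {v,u} = i}" for i
  show "\<exists>i\<in>C. monochromatic V (j i + 2) 2 f i"
  proof (cases "\<exists>u\<in>V - {v}. j (f {v,u}) = 0")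
    case True
    then obtain u where u: "u \<in> V - {v}" "j (f {v,u}) = 0" by blast
    then have e: "{v,u} \<in> nsets V 2" using v by auto
    then have "monochromatic V (j (f {v,u}) + 2) 2 f (f {v,u})"
      unfolding u(2) add_0 by (intro monochromatic_edge)
    then show ?thesis using f e by blast
  next
    case False
    have colour: "f {v,u} \<in> P" if "u \<in> V - {v}" for u
    proof -
      have "{v,u} \<in> nsets V 2" using that v by auto
      then show ?thesis using f False that by (auto simp: P_def)
    qed
    have "V - {v} = (\<Union>i\<in>P. U i)"
      using colour by (auto simp: U_def)
    then have "card (V - {v}) \<le> (\<Sum>i\<in>P. card (U i))"
      using card_UN_le[of P U] C by (simp add: P_def)
    moreover have "card (V - {v}) = card V - 1" using v V by simp
    ultimately have "(\<Sum>i\<in>P. n i) < (\<Sum>i\<in>P. card (U i))"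
      using V by (simp add: P_def)
    then obtain i where i: "i \<in> P" "n i < card (U i)"
      by (meson not_less sum_mono)
    have U: "U i \<subseteq> V" "finite (U i)" using V by (auto simp: U_def)
    have fU: "f \<in> nsets (U i) 2 \<rightarrow> C" using f nsets_Pi_contra[OF U(1), of 2] by (rule rev_subsetD)
    have "n i + 1 \<le> card (U i)" using i by simp
    moreover have "arrows (n i + 1) C (j(i := j i - 1))" using sub[of i] i by (simp add: P_def)
    ultimately obtain i' where i': "i' \<in> C" "monochromatic (U i) ((j(i := j i - 1)) i' + 2) 2 f i'"
      using U(2) fU unfolding arrows_def by blast
    show ?thesis
    \<comment> \<open>A clique of another colour has full size already; one of colour
      \<open>i\<close> is one vertex short, and \<open>v\<close> is added to it.\<close>
    proof (cases "i' = i")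
      case False
      then have "monochromatic V (j i' + 2) 2 f i'"
        using i' monochromatic_superset[OF i'(2) U(1)] by simp
      then show ?thesis using i' by blast
    next
      case True
      then obtain H where H: "H \<in> nsets (U i) (j i + 1)" "f ` nsets H 2 \<subseteq> {i}"
        using i' i by (auto simp: monochromatic_def P_def)
      have vH: "v \<notin> H" "H \<subseteq> V" "finite H" "card H = j i + 1"
        using H U by (auto simp: nsets_def U_def)
      then have "insert v H \<in> nsets V (j i + 2)"
        using v by (simp add: nsets_def)
      moreover have "f e = i" if "e \<in> nsets (insert v H) 2" for e
      proof (cases "v \<in> e")
        case True
        obtain x y where "e = {x,y}" "x \<in> insert v H" "y \<in> insert v H" "x \<noteq> y"
          using nsets2_E[OF \<open>e \<in> nsets (insert v H) 2\<close>] by metis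
        then obtain u where "e = {v,u}" "u \<in> H" using True by auto
        then show ?thesis using H by (auto simp: nsets_def U_def)
      next
        case False
        then have "e \<in> nsets H 2" using that by (auto simp: nsets_def)
        then show ?thesis using H by blast
      qed
      ultimately have "monochromatic V (j i + 2) 2 f i"
        by (auto simp: monochromatic_def)
      then show ?thesis using i by (auto simp: P_def)
    qed
  qed
qed

text \<open>Either a colour with \<open>j i = 0\<close> occurs and its edge is the clique sought, or
  only the at most \<open>s\<close> colours with \<open>0 < j i\<close> occur and the diagonal
  Ramsey number for \<open>s\<close> colours applies.\<close>

lemma arrows_ramsey_number:
  assumes C: "finite C" "card {i\<in>C. 0 < j i} \<le> s" and s: "1 \<le> s"
    and q: "\<And>i. i \<in> C \<Longrightarrow> j i \<le> q"
  shows "arrows (ramsey_number s (q + 2)) C j"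
  unfolding arrows_def
proof (intro allI impI)
  fix V :: "nat set" and f
  define N where "N = ramsey_number s (q + 2)"
  define P where "P = {i\<in>C. 0 < j i}"
  assume V: "finite V" "ramsey_number s (q + 2) \<le> card V" and f: "f \<in> nsets V 2 \<rightarrow> C"
  show "\<exists>i\<in>C. monochromatic V (j i + 2) 2 f i"
  proof (cases "\<exists>e\<in>nsets V 2. j (f e) = 0")
    case True
    then obtain e where e: "e \<in> nsets V 2" "j (f e) = 0" by blast
    then have "monochromatic V (j (f e) + 2) 2 f (f e)"
      unfolding e(2) add_0 by (intro monochromatic_edge)
    then show ?thesis using f e by blast
  next
    case False
    then have fP: "f e \<in> P" if "e \<in> nsets V 2" for e
      using f that by (auto simp: P_def)
    obtain \<phi> where \<phi>: "inj_on \<phi> P" "\<phi> ` P \<subseteq> {..<s}"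
      using C card_le_inj[of P "{..<s}"] by (auto simp: P_def)
    \<comment> \<open>\<open>ramsey_number\<close> concerns only the vertices \<open>{..<N}\<close>
      and the colours \<open>{..<s}\<close>, so the colouring is pulled back along \<open>h\<close>
      and its colours are renamed by \<open>\<phi>\<close>.\<close>
    obtain h where h: "inj_on h {..<N}" "h ` {..<N} \<subseteq> V"
      using card_le_inj[of "{..<N}" V] V by (auto simp: N_def)
    have hn: "h ` e \<in> nsets V m" if "e \<in> nsets {..<N} m" for e m
      using that h card_image[OF inj_on_subset[OF h(1)], of e] by (auto simp: nsets_def)
    have "(\<lambda>e. \<phi> (f (h ` e))) \<in> nsets {..<N} 2 \<rightarrow> {..<s}"
      using hn fP \<phi> by blast
    then obtain a where a: "monochromatic {..<N} (q + 2) 2 (\<lambda>e. \<phi> (f (h ` e))) a"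
      using partn_ramsey_number[OF s, of "q + 2"] unfolding partn_def N_def by blast
    then obtain H where H: "H \<in> nsets {..<N} (q + 2)"
      "\<And>e. e \<in> nsets H 2 \<Longrightarrow> \<phi> (f (h ` e)) = a"
      by (auto simp: monochromatic_def)
    \<comment> \<open>An edge \<open>e0\<close> of the clique supplies an actual colour
      \<open>i\<close> with \<open>\<phi> i = a\<close>; injectivity of \<open>\<phi>\<close> then
      gives every edge the colour \<open>i\<close>.\<close>
    have "2 \<le> card H" using H by (simp add: nsets_def)
    then obtain e0 where e0: "e0 \<subseteq> H" "card e0 = 2" "finite e0"
      using obtain_subset_with_card_n by metis
    define i where "i = f (h ` e0)"
    have HN: "H \<subseteq> {..<N}" using H by (simp add: nsets_def)
    have HV: "h ` H \<subseteq> V" using HN h by blast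
    have e0H: "e0 \<in> nsets H 2" using e0 by (simp add: nsets_def)
    then have e0N: "e0 \<in> nsets {..<N} 2" using nsets_mono[OF HN, of 2] by blast
    then have iP: "i \<in> P" unfolding i_def using fP hn by blast
    have "f d = i" if d: "d \<in> nsets (h ` H) 2" for d
    proof -
      obtain x y where xy: "d = {h x, h y}" "x \<in> H" "y \<in> H" "h x \<noteq> h y"
        using nsets2_E[OF d] by (metis imageE)
      then have "{x,y} \<in> nsets H 2" by auto
      then have "\<phi> (f d) = a" using H(2)[of "{x,y}"] xy by simp
      moreover have "\<phi> i = a" using H(2)[OF e0H] by (simp add: i_def)
      moreover have "f d \<in> P" using fP d nsets_mono[OF HV, of 2] by blast
      ultimately show ?thesis using iP \<phi>(1) by (simp add: inj_on_def)
    qed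
    then have "monochromatic V (q + 2) 2 f i"
      using hn[OF H(1)] by (auto simp: monochromatic_def)
    then show ?thesis
      using monochromatic_smaller[of V "q + 2" 2 f i "j i + 2"] q[of i] iP by (auto simp: P_def)
  qed
qed

lemma ramsey_number_le:
  assumes "arrows N {..<r} (\<lambda>_. k)"
  shows "ramsey_number r (k + 2) \<le> N"
proof -
  have "partn {..<N} (k + 2) 2 {..<r}"
    using assms unfolding arrows_def partn_def by auto
  then show ?thesis unfolding ramsey_number_def by (rule Least_le)
qed

lemma ramsey_number_pos:
  assumes "r \<ge> 1" "k \<ge> 1"
  shows "ramsey_number r k \<ge> 1"
proof (rule ccontr)
  assume "\<not> 1 \<le> ramsey_number r k"
  then have "ramsey_number r k = 0" by simp
  then have "partn ({} :: nat set) k 2 {..<r}" using partn_ramsey_number[OF assms(1), of k] by simp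
  moreover have "(\<lambda>_. 0) \<in> nsets ({} :: nat set) 2 \<rightarrow> {..<r}" using assms by simp
  ultimately obtain H :: "nat set" where "H \<in> nsets {} k"
    unfolding partn_def monochromatic_def by blast
  then show False using assms by (auto simp: nsets_def)
qed

section \<open>Multinomial coefficients\<close>

definition multinom :: "nat set \<Rightarrow> (nat \<Rightarrow> nat) \<Rightarrow> real" where
  "multinom C j = fact (\<Sum>i\<in>C. j i) / (\<Prod>i\<in>C. fact (j i))"

definition repeats :: "nat set \<Rightarrow> (nat \<Rightarrow> nat) \<Rightarrow> real" where
  "repeats C j = (\<Sum>i\<in>C. real (j i) * (real (j i) - 1))"

text \<open>
  The number of words with \<open>j i\<close> letters \<open>i\<close> whose first two letters agree (for at least two
  letters in total).
\<close>
definition multinom_rep :: "nat set \<Rightarrow> (nat \<Rightarrow> nat) \<Rightarrow> real" where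
  "multinom_rep C j = multinom C j * repeats C j /
     (real (\<Sum>i\<in>C. j i) * (real (\<Sum>i\<in>C. j i) - 1))"

lemma prod_fact_le_fact_sum:
  assumes "finite C"
  shows "(\<Prod>i\<in>C. fact (j i)) \<le> (fact (\<Sum>i\<in>C. j i) :: real)"
  using assms
proof induction
  case (insert x F)
  have "(fact (j x) * fact (sum j F) :: nat) \<le> fact (j x + sum j F)"
    by (intro dvd_imp_le fact_fact_dvd_fact) simp
  then have "(fact (j x) * fact (sum j F) :: real) \<le> fact (j x + sum j F)"
    by (metis of_nat_fact of_nat_le_iff of_nat_mult)
  moreover have "fact (j x) * (\<Prod>i\<in>F. fact (j i)) \<le> (fact (j x) * fact (sum j F) :: real)"
    using insert by (intro mult_left_mono) auto
  ultimately show ?case unfolding prod.insert[OF insert(1,2)] sum.insert[OF insert(1,2)]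
    by (rule order_trans[rotated])
qed simp

lemma multinom_ge_1: "finite C \<Longrightarrow> multinom C j \<ge> 1"
  unfolding multinom_def using prod_fact_le_fact_sum[of C j]
  by (simp add: le_divide_eq_1 prod_pos)

lemma sum_decr:
  fixes j :: "nat \<Rightarrow> nat"
  assumes "finite C" "i \<in> C" "0 < j i"
  shows "Suc (\<Sum>a\<in>C. (j(i := j i - 1)) a) = (\<Sum>a\<in>C. j a)"
proof -
  have "(\<Sum>a\<in>C - {i}. (j(i := j i - 1)) a) = (\<Sum>a\<in>C - {i}. j a)"
    by (intro sum.cong) auto
  then show ?thesis
    using assms sum.remove[of C i j] sum.remove[of C i "j(i := j i - 1)"] by simp
qed

lemma multinom_decr:
  assumes "finite C" "i \<in> C" "0 < j i"
  shows "multinom C (j(i := j i - 1)) = multinom C j * real (j i) / real (\<Sum>a\<in>C. j a)"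
proof -
  have "(\<Prod>a\<in>C - {i}. fact ((j(i := j i - 1)) a)) = (\<Prod>a\<in>C - {i}. (fact (j a) :: real))"
    by (intro prod.cong) auto
  moreover have "(fact (j i) :: real) = real (j i) * fact (j i - 1)"
    using assms fact_reduce by blast
  ultimately have p: "(\<Prod>a\<in>C. (fact (j a) :: real)) = real (j i) * (\<Prod>a\<in>C. fact ((j(i := j i - 1)) a))"
    using assms prod.remove[of C i "\<lambda>a. (fact (j a) :: real)"]
      prod.remove[of C i "\<lambda>a. (fact ((j(i := j i - 1)) a) :: real)"] by simp
  define m where "m = (\<Sum>a\<in>C. (j(i := j i - 1)) a)"
  have "(\<Sum>a\<in>C. j a) = Suc m" using sum_decr[of C i j] assms by (simp add: m_def)
  then show ?thesis
    unfolding multinom_def p m_def[symmetric] using assms by (simp del: fun_upd_apply of_nat_Suc)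
qed

lemma repeats_decr:
  assumes "finite C" "i \<in> C" "0 < j i"
  shows "repeats C (j(i := j i - 1)) = repeats C j - 2 * (real (j i) - 1)"
proof -
  let ?g = "\<lambda>j a. real (j a) * (real (j a) - 1)"
  have "(\<Sum>a\<in>C - {i}. ?g (j(i := j i - 1)) a) = (\<Sum>a\<in>C - {i}. ?g j a)"
    by (intro sum.cong) auto
  then show ?thesis
    using assms sum.remove[of C i "?g j"] sum.remove[of C i "?g (j(i := j i - 1))"]
    by (simp add: repeats_def of_nat_diff algebra_simps)
qed

lemma sum_support:
  fixes g :: "nat \<Rightarrow> real"
  assumes "finite C" "\<And>i. i \<in> C \<Longrightarrow> j i = (0::nat) \<Longrightarrow> g i = 0"
  shows "(\<Sum>i\<in>{i\<in>C. 0 < j i}. g i) = (\<Sum>i\<in>C. g i)"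
  using assms by (intro sum.mono_neutral_left) auto

lemma multinom_rec:
  assumes C: "finite C" and pos: "0 < (\<Sum>i\<in>C. j i)"
  shows "(\<Sum>i\<in>{i\<in>C. 0 < j i}. multinom C (j(i := j i - 1))) = multinom C j"
proof -
  have "(\<Sum>i\<in>{i\<in>C. 0 < j i}. multinom C (j(i := j i - 1)))
      = (\<Sum>i\<in>{i\<in>C. 0 < j i}. multinom C j * real (j i) / real (\<Sum>a\<in>C. j a))"
    using C by (intro sum.cong refl multinom_decr) auto
  also have "\<dots> = (\<Sum>i\<in>C. multinom C j * real (j i) / real (\<Sum>a\<in>C. j a))"
    using C by (intro sum_support) auto
  also have "\<dots> = multinom C j * real (\<Sum>i\<in>C. j i) / real (\<Sum>a\<in>C. j a)"
    by (simp add: sum_distrib_left sum_divide_distrib)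
  finally show ?thesis using pos by (simp del: of_nat_sum)
qed

text \<open>Classify the words by their last letter: with at least three letters, deleting it leaves
  the first two intact. The proof is algebraic.\<close>

lemma multinom_rep_rec:
  assumes C: "finite C" and n3: "3 \<le> (\<Sum>i\<in>C. j i)"
  shows "(\<Sum>i\<in>{i\<in>C. 0 < j i}. multinom_rep C (j(i := j i - 1))) = multinom_rep C j"
proof -
  define n where "n = real (\<Sum>i\<in>C. j i)"
  have n: "n \<ge> 3" using n3 unfolding n_def by linarith
  \<comment> \<open>The factor common to all summands: \<open>1 / n\<close> comes from
    \<open>multinom_decr\<close>, the rest of the denominator from the total \<open>n - 1\<close> of
    the shortened vector. The remaining sum is \<open>(n - 2) * repeats C j\<close>.\<close>
  define K where "K = multinom C j / (n * ((n - 1) * (n - 2)))"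
  have "multinom_rep C (j(i := j i - 1))
      = K * (real (j i) * (repeats C j - 2 * (real (j i) - 1)))" if "i \<in> C" "0 < j i" for i
  proof -
    have "real (\<Sum>a\<in>C. (j(i := j i - 1)) a) = n - 1"
      using sum_decr[of C i j] that C unfolding n_def by linarith
    then show ?thesis
      unfolding multinom_rep_def K_def multinom_decr[where j = j, OF C that]
        repeats_decr[where j = j, OF C that]
        n_def[symmetric] by simp
  qed
  then have "(\<Sum>i\<in>{i\<in>C. 0 < j i}. multinom_rep C (j(i := j i - 1)))
      = (\<Sum>i\<in>{i\<in>C. 0 < j i}. K * (real (j i) * (repeats C j - 2 * (real (j i) - 1))))"
    by (intro sum.cong) auto
  also have "\<dots> = (\<Sum>i\<in>C. K * (real (j i) * (repeats C j - 2 * (real (j i) - 1))))"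
    using C by (intro sum_support) auto
  also have "\<dots> = K * (\<Sum>i\<in>C. real (j i) * repeats C j - 2 * (real (j i) * (real (j i) - 1)))"
    by (simp add: sum_distrib_left algebra_simps)
  also have "\<dots> = K * (n * repeats C j - 2 * repeats C j)"
    by (simp add: sum_subtractf n_def repeats_def flip: sum_distrib_right sum_distrib_left)
  also have "\<dots> = multinom_rep C j"
    using n by (simp add: K_def multinom_rep_def n_def[symmetric] divide_simps del: of_nat_sum)
      (simp add: algebra_simps)
  finally show ?thesis .
qed

section \<open>The upper bound\<close>

lemma arrows_level:
  fixes \<alpha> :: real
  assumes C: "finite C" and S: "2 \<le> S" and q: "\<And>i. i \<in> C \<Longrightarrow> j i \<le> q"
    and R3: "real (ramsey_number S 3) \<le> \<alpha> * fact S" and "0 \<le> \<alpha>"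
    and sum: "(\<Sum>i\<in>C. j i) = S"
  shows "\<exists>n. arrows (n + 1) C j \<and> real n + 1 \<le> \<alpha> * multinom C j
    + real (ramsey_number S (q + 2) * S * (S - 1)) * multinom_rep C j"
proof -
  have supp: "card {i\<in>C. 0 < j i} \<le> S"
  proof -
    have "card {i\<in>C. 0 < j i} = (\<Sum>i\<in>{i\<in>C. 0 < j i}. 1)" by simp
    also have "\<dots> \<le> (\<Sum>i\<in>{i\<in>C. 0 < j i}. j i)" by (intro sum_mono) auto
    also have "\<dots> \<le> (\<Sum>i\<in>C. j i)" using C by (intro sum_mono2) auto
    finally show ?thesis using sum by simp
  qed
  have rep: "0 \<le> real (j i) * (real (j i) - 1)" for i by (cases "j i") auto
  have M1: "1 \<le> multinom C j" using C by (rule multinom_ge_1)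
  \<comment> \<open>Needed for the witnesses \<open>n\<close> below, which are Ramsey numbers minus
    1 in truncated subtraction.\<close>
  have pos: "1 \<le> ramsey_number S (m + 2)" for m using S by (intro ramsey_number_pos) auto
  define R where "R = ramsey_number S (q + 2)"
  have SS: "real S * (real S - 1) > 0" using S by simp
  \<comment> \<open>The factor \<open>S * (S - 1)\<close> in the coefficient is there to cancel the
    denominator of \<open>multinom_rep\<close> on this level.\<close>
  have bQ: "real (R * S * (S - 1)) * multinom_rep C j = R * (multinom C j * repeats C j)"
  proof -
    have "real (R * S * (S - 1)) = R * (real S * (real S - 1))"
      using S by (simp add: of_nat_diff)
    moreover have "x * y * (z / y) = x * z" if "y > 0" for x y z :: real
      using that by simp
    ultimately show ?thesis
      using SS unfolding multinom_rep_def sum by presburger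
  qed
  have X0: "0 \<le> repeats C j" unfolding repeats_def using rep by (intro sum_nonneg)
  show ?thesis
  proof (cases "\<forall>i\<in>C. j i \<le> 1")
    case True
    then have "(\<Prod>i\<in>C. fact (j i)) = (\<Prod>i\<in>C. 1 :: real)"
      by (intro prod.cong) (auto simp: le_Suc_eq)
    then have "multinom C j = fact S" by (simp add: multinom_def sum)
    moreover have "arrows (ramsey_number S (1 + 2)) C j"
      using C supp S True by (intro arrows_ramsey_number) auto
    moreover have "0 \<le> real R * (multinom C j * repeats C j)"
      using X0 M1 by simp
    moreover have three: "(1::nat) + 2 = 3" by simp
    ultimately show ?thesis
      using R3 pos[of 1] unfolding R_def[symmetric] bQ three
      by (intro exI[of _ "ramsey_number S 3 - 1"]) (simp add: of_nat_diff)
  next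
    case False
    \<comment> \<open>One entry of at least 2 makes \<open>multinom C j * repeats C j\<close> at
      least 1, so the second term alone dominates the crude bound \<open>R\<close>.\<close>
    then obtain i where i: "i \<in> C" "2 \<le> j i" by force
    have "2 * 1 \<le> real (j i) * (real (j i) - 1)" using i by (intro mult_mono) auto
    also have "\<dots> \<le> repeats C j"
      unfolding repeats_def using C i rep by (intro member_le_sum) auto
    finally have "1 * 1 \<le> multinom C j * repeats C j" using M1 by (intro mult_mono) auto
    then have "real R * 1 \<le> real R * (multinom C j * repeats C j)" by (intro mult_left_mono) auto
    then have "real R \<le> \<alpha> * multinom C j + real R * (multinom C j * repeats C j)"
      using M1 \<open>0 \<le> \<alpha>\<close> by (simp add: add_increasing)
    moreover have "arrows R C j"
      unfolding R_def using C supp S q by (intro arrows_ramsey_number) auto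
    ultimately show ?thesis
      using pos[of q] unfolding R_def[symmetric] bQ
      by (intro exI[of _ "R - 1"]) (simp add: of_nat_diff)
  qed
qed

text \<open>Induction on the total, from \<open>arrows_level\<close> upwards. Bounding the threshold
  \<open>n + 1\<close> itself, not only \<open>n\<close>, makes each nonzero entry contribute an
  extra 1 to the sum, which pays for the 2 in \<open>arrows_step\<close>.\<close>

lemma arrows_bound:
  fixes \<alpha> :: real
  assumes C: "finite C" and S: "2 \<le> S" "q < S" and q: "\<And>i. i \<in> C \<Longrightarrow> j i \<le> q"
    and R3: "real (ramsey_number S 3) \<le> \<alpha> * fact S" and "0 \<le> \<alpha>"
    and sum: "S \<le> (\<Sum>i\<in>C. j i)"
  shows "\<exists>n. arrows (n + 1) C j \<and> real n + 1 \<le> \<alpha> * multinom C j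
    + real (ramsey_number S (q + 2) * S * (S - 1)) * multinom_rep C j"
  using sum q
proof (induction "\<Sum>i\<in>C. j i" arbitrary: j rule: less_induct)
  case less
  define \<beta> where "\<beta> = real (ramsey_number S (q + 2) * S * (S - 1))"
  define P where "P = {i\<in>C. 0 < j i}"
  show ?case
  proof (cases "(\<Sum>i\<in>C. j i) = S")
    case True
    then show ?thesis using arrows_level[of C S j q \<alpha>] C S less.prems R3 \<open>0 \<le> \<alpha>\<close> by blast
  next
    case False
    then have big: "S < (\<Sum>i\<in>C. j i)" using less.prems by simp
    have "\<exists>n. arrows (n + 1) C (j(i := j i - 1)) \<and> real n + 1 \<le>
        \<alpha> * multinom C (j(i := j i - 1)) + \<beta> * multinom_rep C (j(i := j i - 1))" if "i \<in> P" for i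
    proof -
      have "Suc (\<Sum>a\<in>C. (j(i := j i - 1)) a) = (\<Sum>a\<in>C. j a)"
        using sum_decr[of C i j] that C by (simp add: P_def)
      moreover have "(j(i := j i - 1)) a \<le> q" if "a \<in> C" for a
        using less.prems(2)[OF that] less.prems(2)[of i] by auto
      ultimately show ?thesis
        unfolding \<beta>_def using big by (intro less.hyps[of "j(i := j i - 1)"]) linarith+
    qed
    then have "\<forall>i\<in>P. \<exists>n. arrows (n + 1) C (j(i := j i - 1)) \<and> real n + 1 \<le>
        \<alpha> * multinom C (j(i := j i - 1)) + \<beta> * multinom_rep C (j(i := j i - 1))" by blast
    from bchoice[OF this] obtain n where n: "\<And>i. i \<in> P \<Longrightarrow> arrows (n i + 1) C (j(i := j i - 1))"
      "\<And>i. i \<in> P \<Longrightarrow> real (n i) + 1 \<le>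
        \<alpha> * multinom C (j(i := j i - 1)) + \<beta> * multinom_rep C (j(i := j i - 1))"
      by blast
    have arr: "arrows (2 + (\<Sum>i\<in>P. n i)) C j"
      unfolding P_def using C n by (intro arrows_step) (auto simp: P_def)
    have "(\<Sum>i\<in>P. real (n i) + 1)
        \<le> (\<Sum>i\<in>P. \<alpha> * multinom C (j(i := j i - 1)) + \<beta> * multinom_rep C (j(i := j i - 1)))"
      using n by (intro sum_mono) auto
    also have "\<dots> = \<alpha> * multinom C j + \<beta> * multinom_rep C j"
      using multinom_rec[of C j] multinom_rep_rec[of C j] C S big
      by (simp add: P_def sum.distrib flip: sum_distrib_left)
    finally have le: "real (\<Sum>i\<in>P. n i) + real (card P) \<le> \<alpha> * multinom C j + \<beta> * multinom_rep C j"
      by (simp add: sum.distrib)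
    \<comment> \<open>A single nonzero entry would bound the total by \<open>q < S\<close>. With two
      of them, \<open>card P\<close> covers the additive 2.\<close>
    have "card P \<ge> 2"
    proof (rule ccontr)
      assume "\<not> 2 \<le> card P"
      have "(\<Sum>i\<in>C. j i) = (\<Sum>i\<in>P. j i)"
        using C by (intro sum.mono_neutral_right) (auto simp: P_def)
      also have "\<dots> \<le> card P * q"
        using less.prems(2) sum_bounded_above[of P j q] by (auto simp: P_def)
      also have "\<dots> \<le> 1 * q"
        using \<open>\<not> 2 \<le> card P\<close> by (intro mult_right_mono) auto
      finally show False using big S by simp
    qed
    then have "real (1 + (\<Sum>i\<in>P. n i)) + 1 \<le> \<alpha> * multinom C j + \<beta> * multinom_rep C j"
      using le by simp
    moreover have "2 + (\<Sum>i\<in>P. n i) = (1 + (\<Sum>i\<in>P. n i)) + 1" by simp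
    ultimately show ?thesis
      unfolding \<beta>_def[symmetric] using arr
      by (intro exI[of _ "1 + (\<Sum>i\<in>P. n i)"] conjI) (simp_all only:)
  qed
qed

lemma ramsey_number_bound:
  fixes \<alpha> :: real
  assumes S: "2 \<le> S" "q < S" and R3: "real (ramsey_number S 3) \<le> \<alpha> * fact S" and "0 \<le> \<alpha>"
    and r: "S \<le> r * q"
  shows "real (ramsey_number r (q + 2)) \<le> (fact (r * q) / fact q ^ r) *
    (\<alpha> + real (ramsey_number S (q + 2) * S * (S - 1)) * ((real q - 1) / (real r * real q - 1)))"
proof -
  define \<beta> where "\<beta> = real (ramsey_number S (q + 2) * S * (S - 1))"
  have M: "multinom {..<r} (\<lambda>_. q) = fact (r * q) / fact q ^ r"
    by (simp add: multinom_def)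
  have rq: "real r * real q \<noteq> 0"
    using r S by (metis le_zero_eq not_numeral_le_zero of_nat_eq_0_iff of_nat_mult)
  \<comment> \<open>\<open>repeats\<close> equals \<open>r * q * (q - 1)\<close> here and the total
    is \<open>r * q\<close>, so the factor \<open>r * q\<close> cancels.\<close>
  have Q: "multinom_rep {..<r} (\<lambda>_. q)
      = fact (r * q) / fact q ^ r * ((real q - 1) / (real r * real q - 1))"
    using rq unfolding multinom_rep_def M repeats_def by simp
  obtain n where n: "arrows (n + 1) {..<r} (\<lambda>_. q)"
    "real n + 1 \<le> \<alpha> * multinom {..<r} (\<lambda>_. q) + \<beta> * multinom_rep {..<r} (\<lambda>_. q)"
    using arrows_bound[of "{..<r}" S q "\<lambda>_. q" \<alpha>] assms unfolding \<beta>_def by auto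
  have "real (ramsey_number r (q + 2)) \<le> real n + 1"
    using ramsey_number_le[OF n(1)] by linarith
  also note n(2)
  finally show ?thesis
    unfolding M Q \<beta>_def[symmetric] by (simp add: algebra_simps)
qed

theorem theorem7p1:
  fixes k :: nat and c :: real
  assumes "k \<ge> 4" and "c > 0"
    and "\<exists>\<epsilon> :: nat \<Rightarrow> real. \<epsilon> \<longlonglongrightarrow> 0 \<and>
      (\<forall>\<^sub>F r in sequentially. real (ramsey_number r 3) \<le> (3 - c) * fact r * (1 + \<epsilon> r))"
  shows "\<exists>\<delta> :: nat \<Rightarrow> real. \<delta> \<longlonglongrightarrow> 0 \<and>
      (\<forall>\<^sub>F r in sequentially. real (ramsey_number r k)
        \<le> (3 - c / 2) * (fact (r * (k - 2)) / fact (k - 2) ^ r) * (1 + \<delta> r))"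
proof -
  define q where "q = k - 2"
  define \<alpha> where "\<alpha> = 3 - c / 2"
  have q: "q \<ge> 2" "k = q + 2" using assms(1) by (auto simp: q_def)
  obtain \<epsilon> :: "nat \<Rightarrow> real" where \<epsilon>: "\<epsilon> \<longlonglongrightarrow> 0"
    and ev: "\<forall>\<^sub>F r in sequentially. real (ramsey_number r 3) \<le> (3 - c) * fact r * (1 + \<epsilon> r)"
    using assms(3) by blast
  have "(\<lambda>r. (3 - c) * (1 + \<epsilon> r)) \<longlonglongrightarrow> (3 - c) * (1 + 0)"
    by (intro tendsto_intros \<epsilon>)
  \<comment> \<open>The gap between \<open>3 - c\<close> and \<open>3 - c / 2\<close> absorbs the
    error \<open>\<epsilon>\<close>.\<close>
  then have "\<forall>\<^sub>F r in sequentially. (3 - c) * (1 + \<epsilon> r) < \<alpha>"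
    using \<open>c > 0\<close> by (intro order_tendstoD) (auto simp: \<alpha>_def)
  then have "\<forall>\<^sub>F r in sequentially. real (ramsey_number r 3) \<le> \<alpha> * fact r \<and> q < r"
    using ev eventually_gt_at_top[of q]
  proof eventually_elim
    case (elim r)
    have "(3 - c) * fact r * (1 + \<epsilon> r) = ((3 - c) * (1 + \<epsilon> r)) * fact r" by simp
    also have "\<dots> \<le> \<alpha> * fact r" using elim by (intro mult_right_mono) auto
    finally show ?case using elim by linarith
  qed
  \<comment> \<open>\<open>S\<close> is fixed independently of \<open>r\<close>, so
    \<open>\<beta>\<close> below is a constant and \<open>\<delta>\<close> tends to 0.\<close>
  then obtain S where S: "real (ramsey_number S 3) \<le> \<alpha> * fact S" "q < S"
    using eventually_happens'[OF sequentially_bot] by blast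
  \<comment> \<open>Positivity of the Ramsey number rules out \<open>c \<ge> 6\<close>, so the
    division by \<open>\<alpha>\<close> in \<open>\<delta>\<close> is sound.\<close>
  have "0 < real (ramsey_number S 3)"
    using ramsey_number_pos[of S 3] S by simp
  then have "0 < \<alpha> * fact S" using S(1) by linarith
  then have \<alpha>: "0 < \<alpha>" by (simp add: zero_less_mult_iff)
  define \<beta> where "\<beta> = real (ramsey_number S (q + 2) * S * (S - 1))"
  define \<delta> where "\<delta> r = \<beta> / \<alpha> * ((real q - 1) / (real r * real q - 1))" for r
  have "filterlim (\<lambda>r. - 1 + real r * real q) at_top sequentially"
    using q by (intro filterlim_tendsto_add_at_top[OF tendsto_const]
      filterlim_at_top_mult_tendsto_pos[OF tendsto_const] filterlim_real_sequentially) auto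
  then have "(\<lambda>r. (real q - 1) / (- 1 + real r * real q)) \<longlonglongrightarrow> 0"
    by (intro tendsto_divide_0[OF tendsto_const] filterlim_at_top_imp_at_infinity)
  then have "\<delta> \<longlonglongrightarrow> 0"
    unfolding \<delta>_def by (intro tendsto_mult_right_zero) simp
  moreover have "\<forall>\<^sub>F r in sequentially. real (ramsey_number r k)
        \<le> (3 - c / 2) * (fact (r * (k - 2)) / fact (k - 2) ^ r) * (1 + \<delta> r)"
    using eventually_ge_at_top[of S]
  proof eventually_elim
    case (elim r)
    have "S \<le> r * q" using mult_le_mono[of S r 1 q] elim q by simp
    then have "real (ramsey_number r k) \<le> (fact (r * q) / fact q ^ r) *
        (\<alpha> + \<beta> * ((real q - 1) / (real r * real q - 1)))"
      unfolding \<beta>_def q(2) using S q \<alpha> by (intro ramsey_number_bound) auto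
    also have "\<alpha> + \<beta> * ((real q - 1) / (real r * real q - 1)) = \<alpha> * (1 + \<delta> r)"
      using \<alpha> by (simp add: \<delta>_def distrib_left)
    finally show ?case unfolding \<alpha>_def q_def by (simp add: ac_simps)
  qed
  ultimately show ?thesis by blast
qed

end
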